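(* Let $g(z)=\sum_{n=0}^\infty b_n z^n$ be a power series with nonnegative coefficients such that, for some constants $B,L>0$, some finite $R>0$, and some $\beta,\lambda>-1$ with $2\lambda<3\beta+1$, \[ B\,\frac{n^\beta}{R^n}\le b_n\le L\,\frac{n^\lambda}{R^n}\quad\text{for all } n\ge1. \] Then $f=e^g$ is in the Hayman class.
   Context: For a nonconstant power series $f(z)=\sum_{n\ge0}a_nz^n$ with $a_n\ge0$, $a_0>0$ and radius of convergence $R\in(0,\infty]$, its Khinchin family is the family of random variables $(X_t)_{t\in[0,R)}$ with values in $\{0,1,2,\dots\}$ given by $\mathbb P(X_t=n)=a_nt^n/f(t)$ for $t\in(0,R)$. Write $m(t)=\mathbb E(X_t)=tf'(t)/f(t)$, $\sigma^2(t)=\mathbb V(X_t)$, and $\breve X_t=(X_t-m(t))/\sigma(t)$. Such an $f$ is in the Hayman class if there is a function $h\colon[0,R)\to(0,\pi]$ such that: $\lim_{t\uparrow R}\sup_{|\theta|\le h(t)\sigma(t)}\big|\mathbb E(e^{i\theta\breve X_t})e^{\theta^2/2}-1\big|=0$; $\lim_{t\uparrow R}\sigma(t)\sup_{h(t)\sigma(t)\le|\theta|\le\pi\sigma(t)}|\mathbb E(e^{i\theta\breve X_t})|=0$; and $\lim_{t\uparrow R}\sigma(t)=\infty$. *)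

theory Defs
  imports "HOL-Probability.Probability"
begin

text \<open>A power series is given by its coefficient sequence \<open>a\<close>; its radius of convergence
  is \<open>conv_radius a\<close>, an extended real.\<close>

definition khinchin_series :: "(nat \<Rightarrow> real) \<Rightarrow> bool" where
  "khinchin_series a \<longleftrightarrow>
     (\<forall>n. 0 \<le> a n) \<and> 0 < a 0 \<and> (\<exists>n\<ge>1. a n \<noteq> 0) \<and> 0 < conv_radius a"

text \<open>The law of \<open>X\<^sub>t\<close>. Only meaningful for a Khinchin series and \<open>0 \<le> t < conv_radius a\<close>
  (see \<open>pmf_khinchin\<close> below); since \<open>0 ^ 0 = 1\<close>, at \<open>t = 0\<close> it is the point mass at 0.\<close>

definition khinchin_pmf :: "(nat \<Rightarrow> real) \<Rightarrow> real \<Rightarrow> nat pmf" where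
  "khinchin_pmf a t = embed_pmf (\<lambda>n. a n * t ^ n / (\<Sum>k. a k * t ^ k))"

definition khinchin_mean :: "(nat \<Rightarrow> real) \<Rightarrow> real \<Rightarrow> real" where
  "khinchin_mean a t = measure_pmf.expectation (khinchin_pmf a t) real"

definition khinchin_sd :: "(nat \<Rightarrow> real) \<Rightarrow> real \<Rightarrow> real" where
  "khinchin_sd a t = sqrt (measure_pmf.variance (khinchin_pmf a t) real)"

text \<open>The characteristic function of the normalized variable \<open>(X\<^sub>t - m(t)) / \<sigma>(t)\<close>.\<close>

definition khinchin_char :: "(nat \<Rightarrow> real) \<Rightarrow> real \<Rightarrow> real \<Rightarrow> complex" where
  "khinchin_char a t \<theta> = measure_pmf.expectation (khinchin_pmf a t)
     (\<lambda>n. exp (\<i> * of_real (\<theta> * ((real n - khinchin_mean a t) / khinchin_sd a t))))"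

text \<open>The filter \<open>t \<up> R\<close> for \<open>R \<in> (0, \<infinity>]\<close>.\<close>

definition at_radius :: "ereal \<Rightarrow> real filter" where
  "at_radius R = (if R = \<infinity> then at_top else at_left (real_of_ereal R))"

definition hayman_series :: "(nat \<Rightarrow> real) \<Rightarrow> bool" where
  "hayman_series a \<longleftrightarrow> khinchin_series a \<and>
     (\<exists>h :: real \<Rightarrow> real.
        (\<forall>t. 0 \<le> t \<and> ereal t < conv_radius a \<longrightarrow> 0 < h t \<and> h t \<le> pi) \<and>
        ((\<lambda>t. SUP \<theta> \<in> {\<theta>. \<bar>\<theta>\<bar> \<le> h t * khinchin_sd a t}.
                norm (khinchin_char a t \<theta> * of_real (exp (\<theta>\<^sup>2 / 2)) - 1))
           \<longlongrightarrow> 0) (at_radius (conv_radius a)) \<and>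
        ((\<lambda>t. khinchin_sd a t *
              (SUP \<theta> \<in> {\<theta>. h t * khinchin_sd a t \<le> \<bar>\<theta>\<bar> \<and> \<bar>\<theta>\<bar> \<le> pi * khinchin_sd a t}.
                norm (khinchin_char a t \<theta>)))
           \<longlongrightarrow> 0) (at_radius (conv_radius a)) \<and>
        filterlim (khinchin_sd a) at_top (at_radius (conv_radius a)))"

text \<open>A function is in the Hayman class if, on the disc of convergence, it is the sum of a
  Hayman power series. The coefficients \<open>a\<close> are unique, being the Taylor coefficients of \<open>f\<close>
  at 0. Values of \<open>f\<close> outside the disc of convergence are irrelevant.\<close>

definition hayman_class :: "(complex \<Rightarrow> complex) \<Rightarrow> bool" where
  "hayman_class f \<longleftrightarrow> (\<exists>a. hayman_series a \<and>
     (\<forall>z. ereal (norm z) < conv_radius a \<longrightarrow> (\<lambda>n. of_real (a n) * z ^ n) sums f z))"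

lemma pmf_khinchin:
  assumes "khinchin_series a" and "0 \<le> t" and "ereal t < conv_radius a"
  shows "pmf (khinchin_pmf a t) n = a n * t ^ n / (\<Sum>k. a k * t ^ k)"
proof -
  have a: "0 \<le> a n" "0 < a 0" for n
    using assms(1) by (auto simp: khinchin_series_def)
  have sm: "summable (\<lambda>k. a k * t ^ k)"
    using assms(2,3) by (intro summable_in_conv_radius) auto
  have pos: "0 < (\<Sum>k. a k * t ^ k)"
    using a assms(2) by (intro suminf_pos2[OF sm, of 0]) auto
  have nn: "0 \<le> a n * t ^ n / (\<Sum>k. a k * t ^ k)" for n
    using a assms(2) pos by simp
  have "(\<integral>\<^sup>+n. ennreal (a n * t ^ n / (\<Sum>k. a k * t ^ k)) \<partial>count_space UNIV)
      = (\<Sum>n. ennreal (a n * t ^ n / (\<Sum>k. a k * t ^ k)))"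
    by (rule nn_integral_count_space_nat)
  also have "\<dots> = ennreal (\<Sum>n. a n * t ^ n / (\<Sum>k. a k * t ^ k))"
    using nn sm by (intro suminf_ennreal2) (auto intro: summable_divide)
  also have "(\<Sum>n. a n * t ^ n / (\<Sum>k. a k * t ^ k)) = 1"
    using suminf_divide[OF sm, of "\<Sum>k. a k * t ^ k"] pos by simp
  finally show ?thesis
    unfolding khinchin_pmf_def using nn by (intro pmf_embed_pmf) simp_all
qed

end

theory Submission
  imports Defs "HOL-Complex_Analysis.Complex_Analysis" "HOL-Real_Asymp.Real_Asymp"
begin

text \<open>
  For \<open>f = e\<^sup>g\<close> the variable \<open>X\<^sub>t\<close> is compound Poisson: its characteristic function at \<open>\<phi>\<close> is
  \<open>exp (\<Sum>n. b\<^sub>n t\<^sup>n (e\<^bsup>in\<phi>\<^esup> - 1))\<close>, and its variance is \<open>\<Sum>n. n\<^sup>2 b\<^sub>n t\<^sup>n\<close>. Put \<open>d = 1 - t/R\<close> and cut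
  at \<open>h = d\<^sup>\<alpha>\<close>. On the major arc \<open>\<bar>\<phi>\<bar> \<le> h\<close> the cubic Taylor remainder of the exponent is
  \<open>O(h\<^sup>3 \<Sum>n. n\<^sup>3 b\<^sub>n t\<^sup>n) = O(d\<^bsup>3\<alpha> - \<lambda> - 4\<^esup>)\<close>. On the minor arc, the indices \<open>n\<close> of order \<open>1/d\<close>
  alone give \<open>\<Sum>n. b\<^sub>n t\<^sup>n (1 - cos n\<phi>) \<ge> c d\<^bsup>-\<beta>-1\<^esup> min(1, (\<phi>/d)\<^sup>2)\<close>, which is at least
  \<open>c d\<^bsup>-\<epsilon>\<^esup>\<close> for \<open>\<epsilon> = min(\<beta> + 1, \<beta> + 3 - 2\<alpha>)\<close>, so the characteristic function beats the polynomial
  growth of \<open>\<sigma>\<close>. A suitable \<open>\<alpha>\<close> exists exactly when \<open>(\<lambda> + 4)/3 < (\<beta> + 3)/2\<close>, that is,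
  \<open>2\<lambda> < 3\<beta> + 1\<close>.
\<close>

section \<open>Exponentials of power series\<close>

lemma conv_radius_complex_of_real: "conv_radius (\<lambda>n. complex_of_real (b n)) = conv_radius b"
  by (simp add: conv_radius_def)

text \<open>Comparing coefficients in F' = G' F gives the recurrence, and the recurrence gives
  nonnegativity by strong induction. It is exported because the moments of the Khinchin law are
  computed from it. Holomorphy of F on the disc of g gives the bound on the radius.\<close>

lemma exp_power_series:
  fixes b :: "nat \<Rightarrow> real"
  assumes nonneg: "\<And>n. 0 \<le> b n" and pos: "0 < conv_radius b"
  obtains a where "\<And>n. 0 \<le> a n" "a 0 = exp (b 0)"
    "\<And>n. real n * a n = (\<Sum>k\<le>n. real k * b k * a (n - k))"
    "conv_radius b \<le> conv_radius a"
    "\<And>z. ereal (norm z) < conv_radius b \<Longrightarrow>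
       (\<lambda>n. complex_of_real (a n) * z ^ n) sums exp (\<Sum>n. complex_of_real (b n) * z ^ n)"
proof -
  define G where "G = Abs_fps (\<lambda>n. complex_of_real (b n))"
  define F where "F = (\<lambda>z. exp (eval_fps G z))"
  define A where "A = fps_expansion F 0"
  have rad: "fps_conv_radius G = conv_radius b"
    by (simp add: fps_conv_radius_def G_def conv_radius_complex_of_real)
  have hol: "F holomorphic_on eball 0 (conv_radius b)"
    unfolding F_def by (intro holomorphic_intros) (simp add: rad)
  have radA: "conv_radius b \<le> fps_conv_radius A"
    unfolding A_def by (rule conv_radius_fps_expansion[OF hol])
  have evalA: "eval_fps A z = F z" if "ereal (norm z) < conv_radius b" for z
    using eval_fps_expansion'[OF hol that] by (simp add: A_def)
  have FA: "F has_fps_expansion A"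
    unfolding A_def using hol pos by (intro has_fps_expansion_fps_expansion[of "eball 0 (conv_radius b)"]) (auto simp: zero_ereal_def)
  have ev: "eventually (\<lambda>z. z \<in> eball (0::complex) (conv_radius b)) (nhds 0)"
    using pos by (intro eventually_nhds_in_open) (auto simp: zero_ereal_def)
  have "(\<lambda>z. eval_fps (fps_deriv G) z * F z) has_fps_expansion fps_deriv G * A"
    using pos fps_conv_radius_deriv[of G]
    by (intro has_fps_expansion_mult FA eval_fps_has_fps_expansion) (simp add: rad)
  moreover have "eventually (\<lambda>z. eval_fps (fps_deriv G) z * F z = deriv F z) (nhds 0)"
    using ev
  proof eventually_elim
    case (elim z)
    then have "(F has_field_derivative exp (eval_fps G z) * eval_fps (fps_deriv G) z) (at z)"
      unfolding F_def
      by (intro derivative_eq_intros has_field_derivative_eval_fps refl) (auto simp: rad)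
    then show ?case
      by (simp add: DERIV_imp_deriv F_def)
  qed
  ultimately have "deriv F has_fps_expansion fps_deriv G * A"
    by (subst (asm) has_fps_expansion_cong) auto
  then have deriv: "fps_deriv A = fps_deriv G * A"
    using has_fps_expansion_deriv[OF FA] fps_expansion_unique_complex by blast
  \<comment> \<open>The term \<open>k = 0\<close> vanishes, so the sum over the coefficients of G'
    can be shifted to start at 0.\<close>
  have rec: "of_nat n * fps_nth A n = (\<Sum>k\<le>n. of_nat k * of_real (b k) * fps_nth A (n - k))" for n
  proof (cases n)
    case (Suc m)
    have "of_nat n * fps_nth A n = fps_nth (fps_deriv G * A) m"
      by (simp add: Suc flip: deriv)
    also have "\<dots> = (\<Sum>k\<le>m. of_nat (Suc k) * of_real (b (Suc k)) * fps_nth A (n - Suc k))"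
      by (simp add: fps_mult_nth G_def Suc atMost_atLeast0 del: of_nat_Suc)
    also have "\<dots> = (\<Sum>k\<le>n. of_nat k * of_real (b k) * fps_nth A (n - k))"
      unfolding Suc by (subst sum.atMost_Suc_shift) simp
    finally show ?thesis .
  qed auto
  have A0: "fps_nth A 0 = of_real (exp (b 0))"
    using evalA[of 0] pos by (simp add: eval_fps_at_0 F_def G_def exp_of_real flip: zero_ereal_def)
  \<comment> \<open>In the recurrence the n-th coefficient occurs on the right only at
    \<open>k = 0\<close>, with factor 0, so the induction hypothesis covers every other
    term.\<close>
  have real: "fps_nth A n = of_real (Re (fps_nth A n)) \<and> 0 \<le> Re (fps_nth A n)" for n
  proof (induction n rule: less_induct)
    case (less n)
    show ?case
    proof (cases "n = 0")
      case True
      then show ?thesis by (simp add: A0)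
    next
      case False
      define s where "s = (\<Sum>k\<le>n. real k * b k * Re (fps_nth A (n - k)))"
      have "0 \<le> s"
        unfolding s_def
      proof (intro sum_nonneg)
        fix k assume "k \<in> {..n}"
        then show "0 \<le> real k * b k * Re (fps_nth A (n - k))"
          using less[of "n - k"] nonneg[of k] False by (cases "k = 0") auto
      qed
      have "of_nat n * fps_nth A n = of_real s"
        unfolding rec s_def of_real_sum
      proof (intro sum.cong refl)
        fix k assume "k \<in> {..n}"
        then show "of_nat k * of_real (b k) * fps_nth A (n - k)
            = complex_of_real (real k * b k * Re (fps_nth A (n - k)))"
          using less[of "n - k"] False by (cases "k = 0") auto
      qed
      then have "fps_nth A n = of_real (s / real n)"
        using False by (simp add: field_simps)
      then show ?thesis
        using \<open>0 \<le> s\<close> by simp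
    qed
  qed
  define a where "a = (\<lambda>n. Re (fps_nth A n))"
  have Aa: "fps_nth A n = of_real (a n)" for n
    using real by (simp add: a_def)
  have radius: "conv_radius a = fps_conv_radius A"
    by (simp add: fps_conv_radius_def conv_radius_def Aa)
  show ?thesis
  proof (rule that[of a])
    show "0 \<le> a n" for n using real by (simp add: a_def)
    show "a 0 = exp (b 0)" by (simp add: a_def A0)
    have "complex_of_real (real n * a n) = of_real (\<Sum>k\<le>n. real k * b k * a (n - k))" for n
      using rec[of n] by (simp add: Aa)
    then show "real n * a n = (\<Sum>k\<le>n. real k * b k * a (n - k))" for n
      unfolding of_real_eq_iff .
    show "conv_radius b \<le> conv_radius a"
      using radA radius by simp
    fix z :: complex assume z: "ereal (norm z) < conv_radius b"
    have "(\<lambda>n. fps_nth A n * z ^ n) sums eval_fps A z"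
      using z radA by (intro sums_eval_fps) auto
    then show "(\<lambda>n. complex_of_real (a n) * z ^ n) sums exp (\<Sum>n. complex_of_real (b n) * z ^ n)"
      using evalA[OF z] by (simp add: Aa F_def eval_fps_def G_def)
  qed
qed

section \<open>Moments and characteristic function of the Khinchin law\<close>

lemma
  fixes p :: "nat pmf" and h :: "nat \<Rightarrow> 'b :: {banach, second_countable_topology}"
  assumes "summable (\<lambda>n. norm (pmf p n *\<^sub>R h n))"
  shows integrable_nat_pmf: "integrable (measure_pmf p) h"
    and sums_expectation_nat_pmf: "(\<lambda>n. pmf p n *\<^sub>R h n) sums measure_pmf.expectation p h"
proof -
  have int: "integrable (count_space UNIV) (\<lambda>n. pmf p n *\<^sub>R h n)"
    using assms by (simp add: integrable_count_space_nat_iff)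
  then show "integrable (measure_pmf p) h"
    unfolding measure_pmf_eq_density by (subst integrable_density) auto
  have "measure_pmf.expectation p h = integral\<^sup>L (count_space UNIV) (\<lambda>n. pmf p n *\<^sub>R h n)"
    unfolding measure_pmf_eq_density by (subst integral_density) auto
  then show "(\<lambda>n. pmf p n *\<^sub>R h n) sums measure_pmf.expectation p h"
    using sums_integral_count_space_nat[OF int] by simp
qed

text \<open>Multiplying coefficients by n is the operator X d/dX, and formal differentiation does
  not shrink the radius.\<close>

lemma conv_radius_of_nat_mult_ge:
  fixes c :: "nat \<Rightarrow> real"
  shows "conv_radius c \<le> conv_radius (\<lambda>n. real n * c n)"
proof -
  have "conv_radius c = fps_conv_radius (Abs_fps c)"
    by (simp add: fps_conv_radius_def)
  also have "\<dots> \<le> fps_conv_radius (fps_deriv (Abs_fps c))"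
    by (rule fps_conv_radius_deriv)
  also have "\<dots> \<le> fps_conv_radius (fps_X * fps_deriv (Abs_fps c))"
    using fps_conv_radius_mult[of fps_X "fps_deriv (Abs_fps c)"] by simp
  also have "\<dots> = conv_radius (\<lambda>n. real n * c n)"
    unfolding fps_conv_radius_def by (rule conv_radius_cong_weak) auto
  finally show ?thesis .
qed

lemma summable_of_nat_power_mult:
  fixes c :: "nat \<Rightarrow> real"
  assumes "ereal \<bar>t\<bar> < conv_radius c"
  shows "summable (\<lambda>n. \<bar>real n ^ p * c n * t ^ n\<bar>)"
proof -
  have "conv_radius c \<le> conv_radius (\<lambda>n. real n ^ p * c n)"
  proof (induction p)
    case (Suc p)
    then show ?case
      using conv_radius_of_nat_mult_ge[of "\<lambda>n. real n ^ p * c n"] by (auto simp: mult.assoc)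
  qed simp
  then have "summable (\<lambda>n. norm (real n ^ p * c n * t ^ n))"
    using assms by (intro abs_summable_in_conv_radius) auto
  then show ?thesis by simp
qed

text \<open>\<open>rec\<close> is the identity z f' = (z g') f read coefficientwise, so no compound
  Poisson variable has to be constructed. The characteristic function is f(z) / f(t) at z = t exp(i
  \<phi>), up to a phase; since f = exp g, the quotient is exp (g(z) - g(t)), and the linear term in
  the exponent is the centring by the mean.\<close>

lemma
  fixes a b :: "nat \<Rightarrow> real"
  assumes a: "khinchin_series a"
    and rec: "\<And>n. real n * a n = (\<Sum>k\<le>n. real k * b k * a (n - k))"
    and rad: "conv_radius b \<le> conv_radius a"
    and sums: "\<And>z. ereal (norm z) < conv_radius b \<Longrightarrow>
       (\<lambda>n. complex_of_real (a n) * z ^ n) sums exp (\<Sum>n. complex_of_real (b n) * z ^ n)"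
    and t: "0 \<le> t" "ereal t < conv_radius b"
  shows khinchin_sd_exp: "khinchin_sd a t = sqrt (\<Sum>n. (real n)\<^sup>2 * b n * t ^ n)"
    and khinchin_char_exp: "khinchin_char a t \<theta> = exp (\<Sum>n. of_real (b n * t ^ n) *
      (iexp (real n * (\<theta> / khinchin_sd a t)) - 1 - \<i> * of_real (real n * (\<theta> / khinchin_sd a t))))"
proof -
  define m where "m = (\<Sum>n. real n * b n * t ^ n)"
  define v where "v = (\<Sum>n. (real n)\<^sup>2 * b n * t ^ n)"
  define f where "f = (\<Sum>n. a n * t ^ n)"
  have ta: "ereal t < conv_radius a" using t rad by simp
  have smb: "summable (\<lambda>n. \<bar>real n ^ p * b n * t ^ n\<bar>)" for p
    using t by (intro summable_of_nat_power_mult) auto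
  have sma: "summable (\<lambda>n. \<bar>real n ^ p * a n * t ^ n\<bar>)" for p
    using t ta by (intro summable_of_nat_power_mult) auto
  have smb1: "summable (\<lambda>n. \<bar>real n * b n * t ^ n\<bar>)" using smb[of 1] by simp
  have sma1: "summable (\<lambda>n. \<bar>real n * a n * t ^ n\<bar>)" using sma[of 1] by simp
  have sma0: "summable (\<lambda>n. \<bar>a n * t ^ n\<bar>)" using sma[of 0] by simp
  have smb0: "summable (\<lambda>n. \<bar>b n * t ^ n\<bar>)" using smb[of 0] by simp
  have fpos: "0 < f"
    unfolding f_def using a t(1) summable_rabs_cancel[OF sma0]
    by (intro suminf_pos2[of _ 0]) (auto simp: khinchin_series_def)
  note pmf = pmf_khinchin[OF a t(1) ta, folded f_def]
  have split: "t ^ k * t ^ (n - k) = t ^ n" if "k \<le> n" for k n :: nat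
    using that by (simp flip: power_add)
  \<comment> \<open>The recurrence turns the first two moments of \<open>X\<^sub>t\<close> into Cauchy products,
    whence \<open>E X\<^sub>t = m\<close> and \<open>E X\<^sub>t\<^sup>2 = v + m\<^sup>2\<close>.\<close>
  have "(\<lambda>n. \<Sum>k\<le>n. (real k * b k * t ^ k) * (a (n - k) * t ^ (n - k))) sums (m * f)"
    unfolding m_def f_def using smb1 sma0 by (intro Cauchy_product_sums) simp_all
  moreover have "(\<Sum>k\<le>n. (real k * b k * t ^ k) * (a (n - k) * t ^ (n - k))) = real n * a n * t ^ n" for n
    unfolding rec sum_distrib_right by (intro sum.cong refl) (simp add: ac_simps flip: split)
  ultimately have first: "(\<lambda>n. real n * a n * t ^ n) sums (m * f)"
    by simp
  \<comment> \<open>In n (n a_n) the outer factor n is written as k + (n - k) under the sum of the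
    recurrence. The first part pairs k^2 b_k with a, the second pairs k b_k with (n - k) a, whose
    sum is already known from \<open>first\<close>.\<close>
  have "(\<lambda>n. (\<Sum>k\<le>n. ((real k)\<^sup>2 * b k * t ^ k) * (a (n - k) * t ^ (n - k)))
         + (\<Sum>k\<le>n. (real k * b k * t ^ k) * (real (n - k) * a (n - k) * t ^ (n - k))))
        sums (v * f + m * (m * f))"
    unfolding sums_unique[OF first] unfolding m_def f_def v_def
    using smb1 sma0 sma1 smb[of 2] by (intro sums_add Cauchy_product_sums) simp_all
  moreover have "(\<Sum>k\<le>n. ((real k)\<^sup>2 * b k * t ^ k) * (a (n - k) * t ^ (n - k)))
         + (\<Sum>k\<le>n. (real k * b k * t ^ k) * (real (n - k) * a (n - k) * t ^ (n - k)))
         = (real n)\<^sup>2 * a n * t ^ n" for n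
  proof -
    have "(real n)\<^sup>2 * a n * t ^ n = real n * (real n * a n) * t ^ n"
      by (simp add: power2_eq_square)
    also have "\<dots> = (\<Sum>k\<le>n. real n * (real k * b k * a (n - k)) * t ^ n)"
      unfolding rec by (simp add: sum_distrib_left sum_distrib_right)
    also have "\<dots> = (\<Sum>k\<le>n. ((real k)\<^sup>2 * b k * t ^ k) * (a (n - k) * t ^ (n - k))
         + (real k * b k * t ^ k) * (real (n - k) * a (n - k) * t ^ (n - k)))"
      by (intro sum.cong refl)
         (simp add: algebra_simps power2_eq_square flip: split)
    finally show ?thesis by (simp add: sum.distrib)
  qed
  ultimately have second: "(\<lambda>n. (real n)\<^sup>2 * a n * t ^ n) sums (v * f + m * (m * f))"
    by simp
  have sm_pmf: "summable (\<lambda>n. norm (pmf (khinchin_pmf a t) n *\<^sub>R real n ^ p))" for p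
    using summable_divide[OF sma[of p], of f] fpos by (simp add: pmf abs_mult ac_simps)
  have "(\<lambda>n. pmf (khinchin_pmf a t) n *\<^sub>R real n) sums khinchin_mean a t"
    unfolding khinchin_mean_def using sm_pmf[of 1] by (intro sums_expectation_nat_pmf) simp
  moreover have "(\<lambda>n. pmf (khinchin_pmf a t) n *\<^sub>R real n) sums m"
    using sums_divide[OF first, of f] fpos by (simp add: pmf ac_simps)
  ultimately have mean: "khinchin_mean a t = m"
    by (rule sums_unique2)
  have "(\<lambda>n. pmf (khinchin_pmf a t) n *\<^sub>R (real n)\<^sup>2) sums
      measure_pmf.expectation (khinchin_pmf a t) (\<lambda>n. (real n)\<^sup>2)"
    using sm_pmf[of 2] by (intro sums_expectation_nat_pmf) simp
  moreover have "(\<lambda>n. pmf (khinchin_pmf a t) n *\<^sub>R (real n)\<^sup>2) sums (v + m\<^sup>2)"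
    using sums_divide[OF second, of f] fpos
    by (simp add: pmf ac_simps add_divide_distrib power2_eq_square)
  ultimately have "measure_pmf.expectation (khinchin_pmf a t) (\<lambda>n. (real n)\<^sup>2) = v + m\<^sup>2"
    by (rule sums_unique2)
  moreover have "integrable (khinchin_pmf a t) real" "integrable (khinchin_pmf a t) (\<lambda>n. (real n)\<^sup>2)"
    using sm_pmf[of 1] sm_pmf[of 2] by (intro integrable_nat_pmf; simp)+
  ultimately have "measure_pmf.variance (khinchin_pmf a t) real = v"
    using mean by (subst measure_pmf.variance_eq) (auto simp: khinchin_mean_def)
  then show "khinchin_sd a t = sqrt v"
    by (simp add: khinchin_sd_def)
  define \<phi> where "\<phi> = \<theta> / khinchin_sd a t"
  define z where "z = of_real t * iexp \<phi>"
  have normz: "norm z = t" using t by (simp add: z_def norm_mult)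
  have zn: "z ^ n = of_real (t ^ n) * iexp (real n * \<phi>)" for n
    by (simp add: z_def power_mult_distrib exp_of_nat_mult[symmetric] ac_simps)
  have ft: "complex_of_real f = exp (\<Sum>n. complex_of_real (b n * t ^ n))"
  proof (rule sums_unique2)
    show "(\<lambda>n. complex_of_real (a n * t ^ n)) sums complex_of_real f"
      unfolding f_def using summable_rabs_cancel[OF sma0] by (intro sums_of_real summable_sums)
    show "(\<lambda>n. complex_of_real (a n * t ^ n)) sums exp (\<Sum>n. complex_of_real (b n * t ^ n))"
      using sums[of "of_real t"] t by simp
  qed
  have "norm (iexp (\<theta> * ((real n - khinchin_mean a t) / khinchin_sd a t))) = 1" for n
    by simp
  then have "(\<lambda>n. pmf (khinchin_pmf a t) n *\<^sub>R
       iexp (\<theta> * ((real n - khinchin_mean a t) / khinchin_sd a t))) sums khinchin_char a t \<theta>"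
    unfolding khinchin_char_def using sm_pmf[of 0]
    by (intro sums_expectation_nat_pmf) (simp only: norm_scaleR, simp)
  moreover have "(\<lambda>n. (complex_of_real (a n) * z ^ n) * (iexp (- m * \<phi>) / of_real f)) sums
      (exp (\<Sum>n. complex_of_real (b n) * z ^ n) * (iexp (- m * \<phi>) / of_real f))"
    using t normz by (intro sums_mult2 sums) auto
  moreover have "pmf (khinchin_pmf a t) n *\<^sub>R
       iexp (\<theta> * ((real n - khinchin_mean a t) / khinchin_sd a t))
      = (complex_of_real (a n) * z ^ n) * (iexp (- m * \<phi>) / of_real f)" for n
  proof -
    have "\<theta> * ((real n - khinchin_mean a t) / khinchin_sd a t) = real n * \<phi> + (- m * \<phi>)"
      unfolding mean \<phi>_def by (simp add: diff_divide_distrib algebra_simps)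
    then have "iexp (\<theta> * ((real n - khinchin_mean a t) / khinchin_sd a t))
        = iexp (real n * \<phi>) * iexp (- m * \<phi>)"
      by (simp only: of_real_add distrib_left exp_add)
    then show ?thesis
      unfolding zn pmf by (simp only: scaleR_conv_of_real of_real_divide of_real_mult) (simp add: field_simps)
  qed
  ultimately have "khinchin_char a t \<theta> =
      exp (\<Sum>n. complex_of_real (b n) * z ^ n) * (iexp (- m * \<phi>) / of_real f)"
    by (simp add: sums_unique2)
  also have "\<dots> = exp ((\<Sum>n. complex_of_real (b n) * z ^ n) - (\<Sum>n. complex_of_real (b n * t ^ n))
      - \<i> * of_real (m * \<phi>))"
    unfolding ft by (simp add: exp_diff exp_minus divide_inverse mult.assoc)
  \<comment> \<open>The phase \<open>m * \<phi>\<close> is itself a series, since m is the sum of n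
    b_n t^n; this moves the centring inside the sum.\<close>
  also have "(\<Sum>n. complex_of_real (b n) * z ^ n) - (\<Sum>n. complex_of_real (b n * t ^ n))
      - \<i> * of_real (m * \<phi>)
      = (\<Sum>n. of_real (b n * t ^ n) * (iexp (real n * \<phi>) - 1 - \<i> * of_real (real n * \<phi>)))"
  proof (rule sums_unique)
    have "summable (\<lambda>n. complex_of_real (b n) * z ^ n)"
      using smb0 by (intro summable_norm_cancel[of "\<lambda>n. complex_of_real (b n) * z ^ n"])
        (simp add: norm_mult norm_power normz abs_mult t)
    moreover have "summable (\<lambda>n. complex_of_real (b n * t ^ n))"
      using summable_rabs_cancel[OF smb0] by (rule summable_of_real)
    moreover have "(\<lambda>n. complex_of_real (real n * b n * t ^ n)) sums of_real m"
      unfolding m_def using summable_rabs_cancel[OF smb1] by (intro sums_of_real summable_sums)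
    ultimately have "(\<lambda>n. complex_of_real (b n) * z ^ n - complex_of_real (b n * t ^ n)
          - (\<i> * of_real \<phi>) * complex_of_real (real n * b n * t ^ n)) sums
        ((\<Sum>n. complex_of_real (b n) * z ^ n) - (\<Sum>n. complex_of_real (b n * t ^ n))
          - (\<i> * of_real \<phi>) * of_real m)"
      by (intro sums_diff summable_sums sums_mult)
    then show "(\<lambda>n. of_real (b n * t ^ n) * (iexp (real n * \<phi>) - 1 - \<i> * of_real (real n * \<phi>))) sums
        ((\<Sum>n. complex_of_real (b n) * z ^ n) - (\<Sum>n. complex_of_real (b n * t ^ n))
          - \<i> * of_real (m * \<phi>))"
      by (simp add: zn algebra_simps)
  qed
  finally show "khinchin_char a t \<theta> = exp (\<Sum>n. of_real (b n * t ^ n) *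
      (iexp (real n * (\<theta> / khinchin_sd a t)) - 1 - \<i> * of_real (real n * (\<theta> / khinchin_sd a t))))"
    unfolding \<phi>_def .
qed

section \<open>Analytic estimates\<close>

lemma powr_mult_exp_minus_bounded:
  fixes p :: real
  assumes "0 \<le> p"
  obtains K where "0 < K" "\<And>u. 0 \<le> u \<Longrightarrow> u powr p * exp (- u) \<le> K"
proof
  \<comment> \<open>The \<open>+ 1\<close> serves \<open>p = 0\<close>: there
    \<open>0 powr 0 = 0\<close>, while the left side is \<open>exp (- u)\<close> for positive
    u.\<close>
  show "0 < p powr p + 1" by (simp add: add_nonneg_pos)
  fix u :: real assume "0 \<le> u"
  show "u powr p * exp (- u) \<le> p powr p + 1"
  proof (cases "u = 0 \<or> p = 0")
    case True
    then show ?thesis using \<open>0 \<le> u\<close> by auto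
  next
    case False
    then have u: "0 < u" and p: "0 < p" using \<open>0 \<le> u\<close> assms by auto
    have "ln (u / p) \<le> u / p - 1" using u p by (intro ln_le_minus_one) auto
    then have "p * ln (u / p) \<le> p * (u / p - 1)" using p by (intro mult_left_mono) auto
    also have "\<dots> \<le> u" using p by (simp add: algebra_simps)
    finally have "p * ln u - u \<le> p * ln p" using u p by (simp add: ln_div algebra_simps)
    then have "exp (p * ln u - u) \<le> exp (p * ln p)" by simp
    then have "u powr p * exp (- u) \<le> p powr p" using u p by (simp add: powr_def exp_diff exp_minus field_simps)
    then show ?thesis by simp
  qed
qed

text \<open>(1 - d)^n is at most exp(-dn), which is split into two halves. One half absorbs n^p at
  the cost of a factor d^(-p); the other is a geometric series with sum O(1/d).\<close>

lemma power_series_powr_bound: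
  fixes p :: real
  assumes "0 \<le> p"
  obtains C where "0 < C"
    "\<And>d. 0 < d \<Longrightarrow> d \<le> 1 \<Longrightarrow> summable (\<lambda>n. real n powr p * (1 - d) ^ n)"
    "\<And>d. 0 < d \<Longrightarrow> d \<le> 1 \<Longrightarrow> (\<Sum>n. real n powr p * (1 - d) ^ n) \<le> C * d powr - (p + 1)"
proof -
  obtain K where K: "0 < K" "\<And>u. 0 \<le> u \<Longrightarrow> u powr p * exp (- u) \<le> K"
    using powr_mult_exp_minus_bounded[OF assms] by blast
  \<comment> \<open>\<open>K\<close> bounds u^p exp(-u) at u = nd/2, \<open>2 powr p\<close> comes
    from n = (2/d) u, and 4 from 1 - q \<ge> d/4.\<close>
  define C where "C = K * 2 powr p * 4"
  have key: "summable (\<lambda>n. real n powr p * (1 - d) ^ n) \<and>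
      (\<Sum>n. real n powr p * (1 - d) ^ n) \<le> C * d powr - (p + 1)" if d: "0 < d" "d \<le> 1" for d
  proof -
    define q where "q = exp (- (d / 2))"
    have q: "0 < q" "q < 1" using d by (auto simp: q_def)
    have "1 - q \<ge> d / 4"
    proof -
      have "q * (1 + d / 2) \<le> q * exp (d / 2)"
        using q by (intro mult_left_mono exp_ge_add_one_self) auto
      also have "\<dots> = 1" by (simp add: q_def flip: exp_add)
      finally have "q * (1 + d / 2) \<le> 1" .
      moreover have "1 \<le> (1 - d / 4) * (1 + d / 2)"
        using d mult_left_mono[of d 1 d] by (simp add: algebra_simps)
      ultimately have "q * (1 + d / 2) \<le> (1 - d / 4) * (1 + d / 2)" by linarith
      then have "q \<le> 1 - d / 4" using d by (subst (asm) mult_le_cancel_right) auto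
      then show ?thesis by simp
    qed
    have bound: "real n powr p * (1 - d) ^ n \<le> (K * (2 / d) powr p) * q ^ n" for n
    proof -
      have "1 - d \<le> exp (- d)" using exp_ge_add_one_self[of "- d"] by simp
      then have "(1 - d) ^ n \<le> exp (- d) ^ n" using d by (intro power_mono) auto
      also have "\<dots> = exp (- (real n * d / 2)) * q ^ n"
        by (simp add: q_def flip: exp_of_nat_mult exp_add)
      finally have "real n powr p * (1 - d) ^ n \<le>
          real n powr p * (exp (- (real n * d / 2)) * q ^ n)"
        by (intro mult_left_mono) auto
      also have "real n powr p * (exp (- (real n * d / 2)) * q ^ n)
          = (2 / d) powr p * (real n * d / 2) powr p * (exp (- (real n * d / 2)) * q ^ n)"
        using d by (simp flip: powr_mult)
      also have "\<dots> = (2 / d) powr p * q ^ n * ((real n * d / 2) powr p * exp (- (real n * d / 2)))"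
        by (simp add: ac_simps)
      also have "\<dots> \<le> (2 / d) powr p * q ^ n * K"
        using d q by (intro mult_left_mono K) auto
      finally show ?thesis by (simp add: ac_simps)
    qed
    have geo: "(\<lambda>n. (K * (2 / d) powr p) * q ^ n) sums ((K * (2 / d) powr p) * (1 / (1 - q)))"
      using q by (intro sums_mult geometric_sums) auto
    have nn: "0 \<le> real n powr p * (1 - d) ^ n" for n using d by auto
    have sm: "summable (\<lambda>n. real n powr p * (1 - d) ^ n)"
      using bound nn by (intro summable_comparison_test'[OF sums_summable[OF geo]]) auto
    have "(\<Sum>n. real n powr p * (1 - d) ^ n) \<le> (K * (2 / d) powr p) * (1 / (1 - q))"
      using sums_le[OF bound summable_sums[OF sm] geo] .
    also have "\<dots> \<le> (K * (2 / d) powr p) * (4 / d)"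
      using \<open>1 - q \<ge> d / 4\<close> d q K(1) by (intro mult_left_mono) (auto simp: field_simps)
    also have "\<dots> = C * d powr - (p + 1)"
    proof -
      have "d powr - (p + 1) = 1 / (d powr p * d)"
        using d by (simp add: powr_minus_divide powr_add del: minus_add_distrib)
      then show ?thesis using d by (simp add: C_def powr_divide)
    qed
    finally show ?thesis using sm by simp
  qed
  show ?thesis
    using that[of C] key K(1) by (simp add: C_def)
qed

section \<open>Squared sines over a window of indices\<close>

text \<open>Pairing \<open>n\<close> with \<open>n + k\<close>: if \<open>sin (k\<psi>)\<close> is large, the addition formula
  prevents \<open>sin (n\<psi>)\<close> and \<open>sin ((n + k)\<psi>)\<close> from both being small.\<close>

lemma sum_sin_squared_lower_bound:
  fixes \<psi> :: real
  assumes "k \<le> N"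
  shows "real N * (sin (real k * \<psi>))\<^sup>2 / 4 \<le> (\<Sum>n\<in>{N..<3 * N}. (sin (real n * \<psi>))\<^sup>2)"
proof -
  have pair: "(sin (real k * \<psi>))\<^sup>2 \<le> 2 * ((sin (real (n + k) * \<psi>))\<^sup>2 + (sin (real n * \<psi>))\<^sup>2)" for n
  proof -
    define u v where "u = sin (real (n + k) * \<psi>)" and "v = sin (real n * \<psi>)"
    have "sin (real k * \<psi>) = sin (real (n + k) * \<psi> - real n * \<psi>)"
      by (simp add: algebra_simps)
    also have "\<dots> = u * cos (real n * \<psi>) - cos (real (n + k) * \<psi>) * v"
      by (simp add: sin_diff u_def v_def)
    finally have "\<bar>sin (real k * \<psi>)\<bar> \<le> \<bar>u * cos (real n * \<psi>)\<bar> + \<bar>cos (real (n + k) * \<psi>) * v\<bar>"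
      by linarith
    also have "\<dots> \<le> \<bar>u\<bar> * 1 + 1 * \<bar>v\<bar>"
      unfolding abs_mult by (intro add_mono mult_mono) auto
    finally have "\<bar>sin (real k * \<psi>)\<bar> \<le> \<bar>u\<bar> + \<bar>v\<bar>" by simp
    then have "(sin (real k * \<psi>))\<^sup>2 \<le> (\<bar>u\<bar> + \<bar>v\<bar>)\<^sup>2"
      using power_mono[of "\<bar>sin (real k * \<psi>)\<bar>" _ 2] by simp
    also have "\<dots> \<le> 2 * (u\<^sup>2 + v\<^sup>2)"
      using zero_le_power2[of "\<bar>u\<bar> - \<bar>v\<bar>"] by (simp add: power2_diff power2_sum)
    finally show ?thesis by (simp add: u_def v_def)
  qed
  let ?s = "\<lambda>n. (sin (real n * \<psi>))\<^sup>2"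
  have "real N * (sin (real k * \<psi>))\<^sup>2 = (\<Sum>n\<in>{N..<2 * N}. (sin (real k * \<psi>))\<^sup>2)"
    by simp
  also have "\<dots> \<le> (\<Sum>n\<in>{N..<2 * N}. 2 * (?s (n + k) + ?s n))"
    by (intro sum_mono pair)
  also have "\<dots> = 2 * ((\<Sum>n\<in>{N..<2 * N}. ?s (n + k)) + (\<Sum>n\<in>{N..<2 * N}. ?s n))"
    by (simp add: sum.distrib sum_distrib_left)
  \<comment> \<open>As k \<le> N, both the shifted and the unshifted window lie in
    \<open>{N..<3 * N}\<close>. Counting that window twice, together with the factor 2 in
    \<open>pair\<close>, produces the 4.\<close>
  also have "(\<Sum>n\<in>{N..<2 * N}. ?s (n + k)) = (\<Sum>n\<in>{N + k..<2 * N + k}. ?s n)"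
    by (rule sum.shift_bounds_nat_ivl[symmetric])
  also have "\<dots> \<le> (\<Sum>n\<in>{N..<3 * N}. ?s n)"
    using assms by (intro sum_mono2) auto
  also have "(\<Sum>n\<in>{N..<2 * N}. ?s n) \<le> (\<Sum>n\<in>{N..<3 * N}. ?s n)"
    by (intro sum_mono2) auto
  finally show ?thesis by simp
qed

text \<open>If N \<psi> has not passed pi/2, then k = N works because sin y \<ge> y/2 there.
  Otherwise the last multiple of \<psi> not exceeding pi/2 is at least pi/4, so its squared sine is
  at least 1/2.\<close>

lemma exists_sin_multiple_large:
  fixes \<psi> :: real
  assumes "0 < \<psi>" "\<psi> \<le> pi / 2"
  shows "\<exists>k\<le>N. min (1 / 2) ((real N * \<psi> / 2)\<^sup>2) \<le> (sin (real k * \<psi>))\<^sup>2"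
proof (cases "real N * \<psi> \<le> pi / 2")
  case True
  define y where "y = real N * \<psi>"
  have y: "0 \<le> y" using assms by (simp add: y_def)
  have y2: "y \<le> pi / 2" using True by (simp only: y_def)
  have "\<bar>sin y - y\<bar> \<le> y ^ 3 / 6"
  proof -
    have "(\<Sum>m<3. sin_coeff m * y ^ m) = y"
      by (simp add: sin_coeff_def numeral_3_eq_3)
    moreover have "fact 3 = (6 :: real)" by (simp add: fact_numeral)
    ultimately show ?thesis
      using Maclaurin_sin_bound[of y 3] y by simp
  qed
  \<comment> \<open>This amounts to y^2 \<le> 3, which holds because pi/2 \<le> 1.7 and 1.7^2 =
    2.89.\<close>
  moreover have "y ^ 3 / 6 \<le> y / 2"
  proof -
    have "pi \<le> 3.4" by (rule order_trans[OF pi_approx(2)]) simp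
    then have "y \<le> 1.7" using y2 by simp
    then have "y * y \<le> 1.7 * 1.7" using y by (intro mult_mono) auto
    then have "y * (y * y) \<le> y * 3" using y by (intro mult_left_mono) auto
    then show ?thesis by (simp add: power3_eq_cube)
  qed
  ultimately have "y / 2 \<le> sin y" by linarith
  then have "(y / 2)\<^sup>2 \<le> (sin y)\<^sup>2"
    using y by (intro power_mono) auto
  then show ?thesis
    by (intro exI[of _ N]) (simp add: y_def min_le_iff_disj)
next
  case False
  define k where "k = nat \<lfloor>pi / (2 * \<psi>)\<rfloor>"
  have ge1: "1 \<le> pi / (2 * \<psi>)" using assms by (simp add: field_simps)
  then have kint: "int k = \<lfloor>pi / (2 * \<psi>)\<rfloor>" by (simp add: k_def)
  have k1: "real k \<le> pi / (2 * \<psi>)" "pi / (2 * \<psi>) < real k + 1"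
    using kint by linarith+
  have "1 \<le> k" using ge1 k1(2) by linarith
  have "pi / (2 * \<psi>) < real N" using False assms by (simp add: field_simps)
  then have "k \<le> N" using k1 by linarith
  have up: "real k * \<psi> \<le> pi / 2" using k1(1) assms by (simp add: field_simps)
  \<comment> \<open>Since \<psi> \<le> pi/2 forces k \<ge> 1, k + 1 \<le> 2k, so overshooting pi/2
    at k + 1 means that k \<psi> already exceeds pi/4.\<close>
  have "pi < (real k + 1) * \<psi> * 2" using k1(2) assms by (simp add: field_simps)
  also have "\<dots> \<le> (real k + real k) * \<psi> * 2"
    using \<open>1 \<le> k\<close> assms by (intro mult_right_mono) auto
  finally have lo: "pi / 4 \<le> real k * \<psi>" by simp
  have "sin (pi / 4) \<le> sin (real k * \<psi>)"
    using lo up pi_gt_zero by (intro sin_monotone_2pi_le) auto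
  then have "(sqrt 2 / 2)\<^sup>2 \<le> (sin (real k * \<psi>))\<^sup>2"
    by (intro power_mono) (auto simp: sin_45)
  then have "1 / 2 \<le> (sin (real k * \<psi>))\<^sup>2" by (simp add: power_divide)
  then show ?thesis using \<open>k \<le> N\<close> by (intro exI[of _ k]) auto
qed

section \<open>Taylor estimates for the compound Poisson exponent\<close>

lemma norm_exp_minus_one_le: "norm (exp z - 1) \<le> exp (norm z) - 1"
  for z :: "'a :: {banach, real_normed_field}"
proof -
  have z: "(\<lambda>n. z ^ Suc n /\<^sub>R fact (Suc n)) sums (exp z - 1)"
    using exp_converges[of z] by (subst sums_Suc_iff) simp
  have r: "(\<lambda>n. norm z ^ Suc n /\<^sub>R fact (Suc n)) sums (exp (norm z) - 1)"
    using exp_converges[of "norm z"] by (subst sums_Suc_iff) simp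
  show ?thesis
    unfolding sums_unique[OF z] sums_unique[OF r]
    using sums_summable[OF r]
    by (intro norm_suminf_le) (auto simp: norm_mult norm_power norm_divide)
qed

lemma iexp_quadratic_bound: "norm (iexp y - 1 - \<i> * of_real y) \<le> y\<^sup>2 / 2"
  using iexp_approx1[of y 1] by (simp add: algebra_simps power2_eq_square)

lemma iexp_cubic_bound: "norm (iexp y - 1 - \<i> * of_real y + of_real (y\<^sup>2 / 2)) \<le> \<bar>y\<bar> ^ 3 / 6"
proof -
  have s: "(\<Sum>k\<le>2. (\<i> * complex_of_real y) ^ k / fact k) = 1 + \<i> * of_real y - of_real (y\<^sup>2 / 2)"
    by (simp add: numeral_2_eq_2 power2_eq_square algebra_simps)
  have "fact 3 = (6 :: real)" "Suc 2 = 3" by (simp_all add: fact_numeral)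
  then have "norm (iexp y - (1 + \<i> * of_real y - of_real (y\<^sup>2 / 2))) \<le> \<bar>y\<bar> ^ 3 / 6"
    using iexp_approx1[of y 2] unfolding s by metis
  then show ?thesis
    by (simp only: diff_diff_eq2 diff_diff_eq diff_add_eq)
qed

text \<open>Here \<open>w n\<close> stands for b_n t^n. The quadratic Taylor terms add up to the
  Gaussian exponent, leaving a cubic remainder. All real parts are nonpositive, so discarding the
  indices outside S only weakens the decay.\<close>

lemma
  fixes w :: "nat \<Rightarrow> real"
  assumes w: "\<And>n. 0 \<le> w n" and sm2: "summable (\<lambda>n. (real n)\<^sup>2 * w n)"
  defines "T \<equiv> \<lambda>\<phi> n. of_real (w n) * (iexp (real n * \<phi>) - 1 - \<i> * of_real (real n * \<phi>))"
  shows norm_compound_poisson_exponent_le: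
      "summable (\<lambda>n. real n ^ 3 * w n) \<Longrightarrow>
       norm ((\<Sum>n. T \<phi> n) + of_real (\<phi>\<^sup>2 / 2 * (\<Sum>n. (real n)\<^sup>2 * w n)))
         \<le> \<bar>\<phi>\<bar> ^ 3 / 6 * (\<Sum>n. real n ^ 3 * w n)"
    and Re_compound_poisson_exponent_le:
      "finite S \<Longrightarrow> Re (\<Sum>n. T \<phi> n) \<le> - (\<Sum>n\<in>S. w n * (1 - cos (real n * \<phi>)))"
proof -
  have T2: "norm (T \<phi> n) \<le> \<phi>\<^sup>2 / 2 * ((real n)\<^sup>2 * w n)" for n
  proof -
    have "norm (T \<phi> n) \<le> w n * ((real n * \<phi>)\<^sup>2 / 2)"
      unfolding T_def norm_mult using w[of n] iexp_quadratic_bound[of "real n * \<phi>"]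
      by (intro mult_mono) auto
    then show ?thesis by (simp add: power_mult_distrib ac_simps)
  qed
  have smT: "summable (T \<phi>)"
    by (rule summable_comparison_test'[OF summable_mult[OF sm2]]) (rule T2)
  {
    assume sm3: "summable (\<lambda>n. real n ^ 3 * w n)"
    have lim: "(\<lambda>n. T \<phi> n + of_real (\<phi>\<^sup>2 / 2 * ((real n)\<^sup>2 * w n))) sums
        ((\<Sum>n. T \<phi> n) + of_real (\<phi>\<^sup>2 / 2 * (\<Sum>n. (real n)\<^sup>2 * w n)))"
      using smT sm2 by (intro sums_add sums_of_real sums_mult summable_sums)
    have "norm (T \<phi> n + of_real (\<phi>\<^sup>2 / 2 * ((real n)\<^sup>2 * w n)))
        \<le> \<bar>\<phi>\<bar> ^ 3 / 6 * (real n ^ 3 * w n)" for n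
    proof -
      have "T \<phi> n + of_real (\<phi>\<^sup>2 / 2 * ((real n)\<^sup>2 * w n)) =
          of_real (w n) * (iexp (real n * \<phi>) - 1 - \<i> * of_real (real n * \<phi>)
            + of_real ((real n * \<phi>)\<^sup>2 / 2))"
        by (simp add: T_def power_mult_distrib algebra_simps)
      also have "norm \<dots> \<le> w n * (\<bar>real n * \<phi>\<bar> ^ 3 / 6)"
        unfolding norm_mult using w[of n] iexp_cubic_bound[of "real n * \<phi>"]
        by (intro mult_mono) auto
      finally show ?thesis by (simp add: abs_mult power_mult_distrib ac_simps)
    qed
    then have "norm ((\<Sum>n. T \<phi> n) + of_real (\<phi>\<^sup>2 / 2 * (\<Sum>n. (real n)\<^sup>2 * w n)))
        \<le> (\<Sum>n. \<bar>\<phi>\<bar> ^ 3 / 6 * (real n ^ 3 * w n))"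
      unfolding sums_unique[OF lim] by (rule norm_suminf_le[OF _ summable_mult[OF sm3]])
    then show "norm ((\<Sum>n. T \<phi> n) + of_real (\<phi>\<^sup>2 / 2 * (\<Sum>n. (real n)\<^sup>2 * w n)))
         \<le> \<bar>\<phi>\<bar> ^ 3 / 6 * (\<Sum>n. real n ^ 3 * w n)"
      unfolding suminf_mult[OF sm3] .
  }
  {
    assume fin: "finite S"
    have ReT: "Re (T \<phi> n) = - (w n * (1 - cos (real n * \<phi>)))" for n
      by (simp add: T_def Re_exp algebra_simps)
    have sm: "summable (\<lambda>n. w n * (1 - cos (real n * \<phi>)))"
      using summable_minus[OF summable_Re[OF smT]] by (simp add: ReT)
    have "(\<Sum>n\<in>S. w n * (1 - cos (real n * \<phi>))) \<le> (\<Sum>n. w n * (1 - cos (real n * \<phi>)))"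
      using w fin by (intro sum_le_suminf sm) auto
    then show "Re (\<Sum>n. T \<phi> n) \<le> - (\<Sum>n\<in>S. w n * (1 - cos (real n * \<phi>)))"
      using Re_suminf[OF smT] suminf_minus[OF sm] by (simp add: ReT)
  }
qed

text \<open>For N about 1/d and n in \<open>{N..<3 * N}\<close>, n^\<beta> is comparable to
  d^(-\<beta>) and (1 - d)^n is bounded below. Since 1 - cos(n \<phi>) = 2 sin^2(n \<phi>/2), the
  squared-sine estimate applies and contributes a further factor N.\<close>

lemma minor_arc_lower_bound:
  fixes \<beta> :: real
  obtains c where "0 < c"
    "\<And>d \<phi>. 0 < d \<Longrightarrow> d \<le> 1 / 2 \<Longrightarrow> \<phi> \<noteq> 0 \<Longrightarrow> \<bar>\<phi>\<bar> \<le> pi \<Longrightarrow>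
      \<exists>N\<ge>1. c * d powr - (\<beta> + 1) * min 1 ((\<phi> / d)\<^sup>2)
        \<le> (\<Sum>n\<in>{N..<3 * N}. real n powr \<beta> * (1 - d) ^ n * (1 - cos (real n * \<phi>)))"
proof
  \<comment> \<open>A lower bound for x^\<beta> on 1 \<le> x \<le> 6, the range of n d in the
    window, whatever the sign of \<beta>.\<close>
  define c1 where "c1 = min 1 (6 powr \<beta>)"
  have c1: "0 < c1" by (simp add: c1_def)
  \<comment> \<open>\<open>exp (- 12)\<close> bounds (1 - d)^n below; 1/32 is 2 (double angle) times
    1/16 (\<open>half\<close>) times 1/4 (the squared-sine sum).\<close>
  then show "0 < c1 * exp (- 12) / 32" by simp
  fix d \<phi> :: real
  assume d: "0 < d" "d \<le> 1 / 2" and \<phi>: "\<phi> \<noteq> 0" "\<bar>\<phi>\<bar> \<le> pi"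
  define N where "N = nat \<lceil>1 / d\<rceil>"
  have d1: "1 \<le> 1 / d" using d by (simp add: field_simps)
  then have "int N = \<lceil>1 / d\<rceil>" unfolding N_def by linarith
  then have N: "1 / d \<le> real N" "real N < 1 / d + 1" by linarith+
  then have "1 \<le> N" using d1 by linarith
  have N2: "real N \<le> 2 / d" using N d1 by simp
  define \<psi> where "\<psi> = \<bar>\<phi>\<bar> / 2"
  have \<psi>: "0 < \<psi>" "\<psi> \<le> pi / 2" using \<phi> by (auto simp: \<psi>_def)
  obtain k where k: "k \<le> N" "min (1 / 2) ((real N * \<psi> / 2)\<^sup>2) \<le> (sin (real k * \<psi>))\<^sup>2"
    using exists_sin_multiple_large[OF \<psi>] by blast
  have termwise: "c1 * d powr - \<beta> * exp (- 12) * (2 * (sin (real n * \<psi>))\<^sup>2)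
      \<le> real n powr \<beta> * (1 - d) ^ n * (1 - cos (real n * \<phi>))" if n: "n \<in> {N..<3 * N}" for n
  proof (intro mult_mono)
    have "1 / d \<le> real n" using n N by simp
    moreover have "real n \<le> 3 * real N" using n by simp
    then have "real n \<le> 6 / d" using N2 by simp
    ultimately have nd: "1 \<le> real n * d" "real n * d \<le> 6" using d by (simp_all add: field_simps)
    have "c1 \<le> (real n * d) powr \<beta>"
    proof (cases "0 \<le> \<beta>")
      case True
      then have "1 \<le> (real n * d) powr \<beta>" using nd by (intro ge_one_powr_ge_zero) auto
      then show ?thesis by (simp add: c1_def)
    next
      case False
      then have "6 powr \<beta> \<le> (real n * d) powr \<beta>" using nd by (intro powr_mono2') auto
      then show ?thesis by (simp add: c1_def)
    qed
    then have "c1 * d powr - \<beta> \<le> (real n * d) powr \<beta> * d powr - \<beta>"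
      by (intro mult_right_mono) auto
    also have "\<dots> = real n powr \<beta>"
      using d by (simp add: powr_mult powr_minus field_simps)
    finally show "c1 * d powr - \<beta> \<le> real n powr \<beta>" .
    \<comment> \<open>With d \<le> 1/2 this gives ln(1 - d) \<ge> -2d, and n d \<le> 6 then yields
      the exponent -12.\<close>
    have "- (2 * d) \<le> - d - 2 * d\<^sup>2"
      using d mult_left_mono[of d "1 / 2" d] by (simp add: power2_eq_square)
    also have "\<dots> \<le> ln (1 - d)" using d by (intro ln_one_minus_pos_lower_bound) auto
    finally have "real n * - (2 * d) \<le> real n * ln (1 - d)" by (intro mult_left_mono) auto
    moreover have "- 12 \<le> real n * - (2 * d)" using nd(2) by (simp add: mult.commute)
    ultimately have "- 12 \<le> real n * ln (1 - d)" by linarith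
    then have "exp (- 12) \<le> exp (real n * ln (1 - d))" by simp
    also have "\<dots> = (1 - d) ^ n" using d by (simp add: exp_of_nat_mult)
    finally show "exp (- 12) \<le> (1 - d) ^ n" .
    have "cos (real n * \<phi>) = cos (2 * (real n * \<psi>))"
      by (cases "0 \<le> \<phi>") (auto simp: \<psi>_def)
    then show "2 * (sin (real n * \<psi>))\<^sup>2 \<le> 1 - cos (real n * \<phi>)"
      by (simp add: cos_double_sin)
  qed (use c1 d in auto)
  have half: "(1 / 16) * min 1 ((\<phi> / d)\<^sup>2) \<le> (sin (real k * \<psi>))\<^sup>2"
  proof -
    have "\<bar>\<phi>\<bar> / (4 * d) \<le> real N * \<psi> / 2"
      using mult_right_mono[OF N(1), of "\<bar>\<phi>\<bar>"] by (simp add: \<psi>_def)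
    then have "(\<bar>\<phi>\<bar> / (4 * d))\<^sup>2 \<le> (real N * \<psi> / 2)\<^sup>2"
      using d by (intro power_mono) auto
    moreover have "(\<bar>\<phi>\<bar> / (4 * d))\<^sup>2 = (1 / 16) * (\<phi> / d)\<^sup>2"
      by (simp add: power_divide power_mult_distrib)
    ultimately have "(1 / 16) * min 1 ((\<phi> / d)\<^sup>2) \<le> min (1 / 2) ((real N * \<psi> / 2)\<^sup>2)"
      by (simp add: min_def)
    then show ?thesis using k(2) by linarith
  qed
  have "c1 * exp (- 12) / 32 * d powr - (\<beta> + 1) * min 1 ((\<phi> / d)\<^sup>2)
      = c1 * d powr - \<beta> * exp (- 12) * (2 * ((1 / d) * ((1 / 16) * min 1 ((\<phi> / d)\<^sup>2)) / 4))"
  proof -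
    have "d powr - (\<beta> + 1) = d powr - \<beta> * (1 / d)"
      using d by (simp add: powr_minus_divide powr_add del: minus_add_distrib)
    then show ?thesis by simp
  qed
  also have "\<dots> \<le> c1 * d powr - \<beta> * exp (- 12) * (2 * (real N * (sin (real k * \<psi>))\<^sup>2 / 4))"
    using c1 d N half by (intro mult_left_mono divide_right_mono mult_mono) auto
  also have "\<dots> \<le> c1 * d powr - \<beta> * exp (- 12) * (2 * (\<Sum>n\<in>{N..<3 * N}. (sin (real n * \<psi>))\<^sup>2))"
    using c1 by (intro mult_left_mono sum_sin_squared_lower_bound k) auto
  also have "\<dots> = (\<Sum>n\<in>{N..<3 * N}. c1 * d powr - \<beta> * exp (- 12) * (2 * (sin (real n * \<psi>))\<^sup>2))"
    by (simp add: sum_distrib_left)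
  also have "\<dots> \<le> (\<Sum>n\<in>{N..<3 * N}. real n powr \<beta> * (1 - d) ^ n * (1 - cos (real n * \<phi>)))"
    by (intro sum_mono termwise)
  finally show "\<exists>N\<ge>1. c1 * exp (- 12) / 32 * d powr - (\<beta> + 1) * min 1 ((\<phi> / d)\<^sup>2)
        \<le> (\<Sum>n\<in>{N..<3 * N}. real n powr \<beta> * (1 - d) ^ n * (1 - cos (real n * \<phi>)))"
    using \<open>1 \<le> N\<close> by blast
qed

text \<open>Comparison with the series of n^(lam + p) (1 - d)^n, d = 1 - t/R. Taking p \<ge> 1 makes
  that exponent nonnegative and removes the term n = 0, about which \<open>up\<close> says
  nothing.\<close>

lemma power_series_moment_bound:
  fixes b :: "nat \<Rightarrow> real" and L R lam :: real
  assumes b: "\<And>n. 0 \<le> b n" and "0 < L" "0 < R" "-1 < lam" "1 \<le> p"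
    and up: "\<And>n. 1 \<le> n \<Longrightarrow> b n \<le> L * (real n powr lam / R ^ n)"
  obtains C where "0 < C"
    "\<And>t. 0 \<le> t \<Longrightarrow> t < R \<Longrightarrow> summable (\<lambda>n. real n ^ p * (b n * t ^ n))"
    "\<And>t. 0 \<le> t \<Longrightarrow> t < R \<Longrightarrow>
       (\<Sum>n. real n ^ p * (b n * t ^ n)) \<le> C * (1 - t / R) powr - (lam + real p + 1)"
proof -
  define q where "q = lam + real p"
  have "0 \<le> q" using assms by (simp add: q_def)
  then obtain C where C: "0 < C"
    "\<And>d. 0 < d \<Longrightarrow> d \<le> 1 \<Longrightarrow> summable (\<lambda>n. real n powr q * (1 - d) ^ n)"
    "\<And>d. 0 < d \<Longrightarrow> d \<le> 1 \<Longrightarrow> (\<Sum>n. real n powr q * (1 - d) ^ n) \<le> C * d powr - (q + 1)"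
    by (rule power_series_powr_bound) blast
  have key: "summable (\<lambda>n. real n ^ p * (b n * t ^ n)) \<and>
      (\<Sum>n. real n ^ p * (b n * t ^ n)) \<le> (L * C) * (1 - t / R) powr - (lam + real p + 1)"
    if t: "0 \<le> t" "t < R" for t
  proof -
    define d where "d = 1 - t / R"
    have d: "0 < d" "d \<le> 1" using t assms by (auto simp: d_def)
    have le: "real n ^ p * (b n * t ^ n) \<le> L * (real n powr q * (1 - d) ^ n)" for n
    proof (cases "n = 0")
      case False
      have "real n ^ p * (b n * t ^ n) \<le> real n ^ p * (L * (real n powr lam / R ^ n) * t ^ n)"
        using t False by (intro mult_left_mono mult_right_mono up) auto
      also have "\<dots> = L * (real n powr q * (1 - d) ^ n)"
        using False by (simp add: q_def d_def powr_add powr_realpow power_divide)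
      finally show ?thesis .
    qed (use \<open>1 \<le> p\<close> in \<open>simp add: zero_power\<close>)
    have sm: "summable (\<lambda>n. L * (real n powr q * (1 - d) ^ n))"
      by (intro summable_mult C d)
    have sm': "summable (\<lambda>n. real n ^ p * (b n * t ^ n))"
      using le b t by (intro summable_comparison_test'[OF sm]) auto
    moreover have "(\<Sum>n. real n ^ p * (b n * t ^ n)) \<le> (\<Sum>n. L * (real n powr q * (1 - d) ^ n))"
      by (intro suminf_le le sm sm')
    moreover have "\<dots> = L * (\<Sum>n. real n powr q * (1 - d) ^ n)"
      by (intro suminf_mult C d)
    moreover have "\<dots> \<le> L * (C * d powr - (q + 1))"
      using \<open>0 < L\<close> by (intro mult_left_mono C d) auto
    ultimately show ?thesis by (simp add: d_def q_def)
  qed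
  show ?thesis
    using that[of "L * C"] key C(1) \<open>0 < L\<close> by simp
qed

section \<open>Limits and suprema\<close>

lemma powr_mult_exp_powr_tendsto_0:
  fixes K p c e :: real
  assumes "0 < e" "0 < c"
  shows "((\<lambda>d. K * d powr - p * exp (- (c * d powr - e))) \<longlongrightarrow> 0) (at_right 0)"
  using assms by real_asymp

text \<open>A real \<open>SUP\<close> is only informative over a nonempty bounded family, hence both
  requirements in \<open>ev\<close>. The weight c is 1 on the major arc and the standard deviation
  on the minor arc.\<close>

lemma SUP_tendsto_zero:
  fixes f :: "'a \<Rightarrow> 'b \<Rightarrow> real" and c :: "'a \<Rightarrow> real"
  assumes ev: "eventually (\<lambda>t. 0 \<le> c t \<and> S t \<noteq> {} \<and> (\<forall>x\<in>S t. 0 \<le> f t x \<and> f t x \<le> g t)) F"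
    and lim: "((\<lambda>t. c t * g t) \<longlongrightarrow> 0) F"
  shows "((\<lambda>t. c t * (SUP x\<in>S t. f t x)) \<longlongrightarrow> 0) F"
proof (rule tendsto_sandwich[OF _ _ tendsto_const lim])
  show "eventually (\<lambda>t. 0 \<le> c t * (SUP x\<in>S t. f t x)) F"
    using ev
  proof eventually_elim
    case (elim t)
    then obtain x where x: "x \<in> S t" by auto
    have "0 \<le> f t x" using elim x by auto
    also have "\<dots> \<le> (SUP x\<in>S t. f t x)"
      using elim x by (intro cSUP_upper bdd_aboveI2[of _ _ "g t"]) auto
    finally show ?case using elim by auto
  qed
  show "eventually (\<lambda>t. c t * (SUP x\<in>S t. f t x) \<le> c t * g t) F"
    using ev by eventually_elim (intro mult_left_mono cSUP_least; auto)
qed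

section \<open>The Hayman class\<close>

theorem theorem5p6:
  fixes b :: "nat \<Rightarrow> real" and B L R \<beta> lam :: real
  assumes "\<And>n. 0 \<le> b n"
    and "0 < B" and "0 < L" and "0 < R"
    and "-1 < \<beta>" and "-1 < lam" and "2 * lam < 3 * \<beta> + 1"
    and "\<And>n. 1 \<le> n \<Longrightarrow> B * (real n powr \<beta> / R ^ n) \<le> b n"
    and "\<And>n. 1 \<le> n \<Longrightarrow> b n \<le> L * (real n powr lam / R ^ n)"
  shows "hayman_class (\<lambda>z. exp (\<Sum>n. of_real (b n) * z ^ n))"
proof -
  note b = assms(1) and lower = assms(8) and upper = assms(9)
  have moments: "\<exists>C>0. \<forall>t. 0 \<le> t \<and> t < R \<longrightarrow> summable (\<lambda>n. real n ^ p * (b n * t ^ n)) \<and>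
      (\<Sum>n. real n ^ p * (b n * t ^ n)) \<le> C * (1 - t / R) powr - (lam + real p + 1)"
    if p: "1 \<le> p" for p
    by (rule power_series_moment_bound[OF assms(1,3,4,6) p upper]) blast+
  have sm1: "summable (\<lambda>n. real n ^ p * (b n * t ^ n))" if "1 \<le> p" "0 \<le> t" "t < R" for p t
    using moments[of p] that by blast

  \<comment> \<open>Radius of convergence of both series\<close>
  have rad_b_ge: "ereal R \<le> conv_radius b"
  proof (rule conv_radius_geI_ex)
    fix r :: real assume r: "0 < r" "ereal r < ereal R"
    \<comment> \<open>The moment bounds start at p = 1, so the series itself is dominated by its
      first moment.\<close>
    then have "summable (\<lambda>n. real n * (b n * r ^ n))" using sm1[of 1 r] by simp
    then have "summable (\<lambda>n. b n * r ^ n)"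
    proof (rule summable_comparison_test'[of _ 1])
      fix n :: nat assume "1 \<le> n"
      then have "1 * (b n * r ^ n) \<le> real n * (b n * r ^ n)"
        using b r by (intro mult_right_mono) auto
      then show "norm (b n * r ^ n) \<le> real n * (b n * r ^ n)" using b r by simp
    qed
    then show "\<exists>z. norm z = r \<and> summable (\<lambda>n. b n * z ^ n)" using r by (intro exI[of _ r]) auto
  qed
  moreover have "0 < ereal R" using \<open>0 < R\<close> by simp
  ultimately have rad_b_pos: "0 < conv_radius b" by order
  obtain a where a: "\<And>n. 0 \<le> a n" "a 0 = exp (b 0)"
    "\<And>n. real n * a n = (\<Sum>k\<le>n. real k * b k * a (n - k))"
    "conv_radius b \<le> conv_radius a"
    "\<And>z. ereal (norm z) < conv_radius b \<Longrightarrow>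
       (\<lambda>n. complex_of_real (a n) * z ^ n) sums exp (\<Sum>n. complex_of_real (b n) * z ^ n)"
    by (rule exp_power_series[OF b rad_b_pos]) blast
  \<comment> \<open>Only the term \<open>k = n\<close> of the recurrence is kept.\<close>
  have a_ge: "b n * exp (b 0) \<le> a n" if "1 \<le> n" for n
  proof -
    have "real n * b n * a (n - n) \<le> (\<Sum>k\<le>n. real k * b k * a (n - k))"
      by (intro member_le_sum) (auto simp: a(1) b)
    then have "real n * (b n * exp (b 0)) \<le> real n * a n" by (simp add: a(2) flip: a(3))
    then show ?thesis using that by simp
  qed
  have b_pos: "0 < b n" if "1 \<le> n" for n
  proof -
    have "0 < B * (real n powr \<beta> / R ^ n)" using that assms by simp
    then show ?thesis using lower[OF that] by linarith
  qed
  \<comment> \<open>Otherwise the series of a_n R^n would converge, although its terms dominate a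
    multiple of n^\<beta> \<ge> 1/n. This closes the chain R \<le> \<open>conv_radius b\<close>
    \<le> \<open>conv_radius a\<close> \<le> R.\<close>
  have "conv_radius a \<le> ereal R"
  proof (rule ccontr)
    assume "\<not> ?thesis"
    then have "summable (\<lambda>n. a n * R ^ n)"
      using \<open>0 < R\<close> by (intro summable_in_conv_radius) auto
    then have "summable (\<lambda>n. a n * R ^ n / (B * exp (b 0)))" by (rule summable_divide)
    then have "summable (\<lambda>n. inverse (real n))"
    proof (rule summable_comparison_test'[of _ 1])
      fix n :: nat assume n: "1 \<le> n"
      have "inverse (real n) = real n powr - 1" using n by (simp add: powr_minus)
      also have "\<dots> \<le> real n powr \<beta>" using n \<open>-1 < \<beta>\<close> by (intro powr_mono) auto
      also have "\<dots> = B * (real n powr \<beta> / R ^ n) * (R ^ n / B)"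
        using \<open>0 < B\<close> \<open>0 < R\<close> by simp
      also have "\<dots> \<le> b n * (R ^ n / B)"
        using \<open>0 < B\<close> \<open>0 < R\<close> by (intro mult_right_mono lower n) auto
      also have "\<dots> = b n * exp (b 0) * (R ^ n / (B * exp (b 0)))" by simp
      also have "\<dots> \<le> a n * (R ^ n / (B * exp (b 0)))"
        using \<open>0 < B\<close> \<open>0 < R\<close> by (intro mult_right_mono a_ge n) auto
      finally show "norm (inverse (real n)) \<le> a n * R ^ n / (B * exp (b 0))" by simp
    qed
    then show False using not_summable_harmonic[where 'a = real] by simp
  qed
  with rad_b_ge a(4) have rad: "conv_radius a = ereal R" "conv_radius b = ereal R"
    by order+
  have kh: "khinchin_series a"
    using a(1,2) a_ge[of 1] b_pos[of 1] \<open>0 < R\<close> rad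
    by (auto simp: khinchin_series_def intro!: exI[of _ 1])
       (metis exp_gt_zero mult_pos_pos not_less zero_less_one less_irrefl)

  \<comment> \<open>Constants, exponents and the variance\<close>
  obtain C2 where C2: "0 < C2" "\<And>t. 0 \<le> t \<Longrightarrow> t < R \<Longrightarrow>
      (\<Sum>n. (real n)\<^sup>2 * (b n * t ^ n)) \<le> C2 * (1 - t / R) powr - (lam + 3)"
    using moments[of 2] by (auto simp: algebra_simps)
  obtain C3 where C3: "0 < C3" "\<And>t. 0 \<le> t \<Longrightarrow> t < R \<Longrightarrow>
      (\<Sum>n. real n ^ 3 * (b n * t ^ n)) \<le> C3 * (1 - t / R) powr - (lam + 4)"
    using moments[of 3] by (auto simp: algebra_simps)
  obtain c where c: "0 < c"
    "\<And>d \<phi>. 0 < d \<Longrightarrow> d \<le> 1 / 2 \<Longrightarrow> \<phi> \<noteq> 0 \<Longrightarrow> \<bar>\<phi>\<bar> \<le> pi \<Longrightarrow>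
      \<exists>N\<ge>1. c * d powr - (\<beta> + 1) * min 1 ((\<phi> / d)\<^sup>2)
        \<le> (\<Sum>n\<in>{N..<3 * N}. real n powr \<beta> * (1 - d) ^ n * (1 - cos (real n * \<phi>)))"
    by (rule minor_arc_lower_bound[of \<beta>]) blast

  \<comment> \<open>Any exponent strictly between \<open>(lam + 4) / 3\<close> (needed on the major arc) and
    \<open>(\<beta> + 3) / 2\<close> (needed on the minor arc) would do.\<close>
  define \<alpha> where "\<alpha> = ((lam + 4) / 3 + (\<beta> + 3) / 2) / 2"
  have \<alpha>: "lam + 4 < 3 * \<alpha>" "2 * \<alpha> < \<beta> + 3" "0 < \<alpha>"
    using assms by (auto simp: \<alpha>_def field_simps)
  \<comment> \<open>The two entries are the decay exponents from the two branches of
    \<open>min 1 ((\<phi> / d)\<^sup>2)\<close> when \<bar>\<phi>\<bar> \<ge> d^\<alpha>.\<close>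
  define \<epsilon> where "\<epsilon> = min (\<beta> + 1) (\<beta> + 3 - 2 * \<alpha>)"
  have \<epsilon>: "0 < \<epsilon>" using \<alpha> assms by (simp add: \<epsilon>_def)
  define h where "h = (\<lambda>t. (1 - t / R) powr \<alpha>)"
  let ?\<sigma> = "khinchin_sd a"
  let ?V = "\<lambda>t. \<Sum>n. (real n)\<^sup>2 * (b n * t ^ n)"
  let ?T = "\<lambda>t \<phi>. \<Sum>n. of_real (b n * t ^ n) * (iexp (real n * \<phi>) - 1 - \<i> * of_real (real n * \<phi>))"
  have w: "0 \<le> b n * t ^ n" if "0 \<le> t" for n t using b that by simp
  have sd: "?\<sigma> t = sqrt (?V t)" if "0 \<le> t" "t < R" for t
    using khinchin_sd_exp[OF kh a(3,4,5)] that by (simp add: rad mult.assoc)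
  have char: "khinchin_char a t \<theta> = exp (?T t (\<theta> / ?\<sigma> t))" if "0 \<le> t" "t < R" for t \<theta>
    using khinchin_char_exp[OF kh a(3,4,5)] that by (simp add: rad)
  \<comment> \<open>A crude bound suffices for positivity and divergence of the variance: n^(2 +
    \<beta>) \<ge> 1 leaves a geometric series starting at n = 1.\<close>
  have V_ge: "B * (1 - d) / d \<le> ?V t" if t: "0 \<le> t" "t < R" and d: "d = 1 - t / R" for t d
  proof -
    have "0 < d" "d \<le> 1" using t \<open>0 < R\<close> by (auto simp: d)
    have geo: "(\<lambda>n. B * (1 - d) * (1 - d) ^ n) sums (B * (1 - d) * (1 / (1 - (1 - d))))"
      using \<open>0 < d\<close> \<open>d \<le> 1\<close> by (intro sums_mult geometric_sums) auto
    have shifted: "(\<lambda>n. (real (Suc n))\<^sup>2 * (b (Suc n) * t ^ Suc n)) sums ?V t"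
      using sm1[of 2 t] t by (subst sums_Suc_iff) (simp add: summable_sums)
    have "B * (1 - d) * (1 - d) ^ n \<le> (real (Suc n))\<^sup>2 * (b (Suc n) * t ^ Suc n)" for n
    proof -
      define m where "m = Suc n"
      have m: "1 \<le> real m" by (simp add: m_def)
      have "B * (t / R) ^ m = B * (real m powr 0 / R ^ m) * t ^ m"
        using m by (simp add: power_divide)
      also have "\<dots> \<le> B * (real m powr (2 + \<beta>) / R ^ m) * t ^ m"
        using m assms t by (intro mult_right_mono mult_left_mono divide_right_mono powr_mono) auto
      also have "\<dots> = (real m)\<^sup>2 * (B * (real m powr \<beta> / R ^ m) * t ^ m)"
        using m by (simp add: powr_add)
      also have "\<dots> \<le> (real m)\<^sup>2 * (b m * t ^ m)"
        using m t by (intro mult_left_mono mult_right_mono lower) auto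
      finally show ?thesis by (simp add: m_def d)
    qed
    from sums_le[OF this geo shifted] show ?thesis by simp
  qed

  have filt: "filterlim (\<lambda>t. 1 - t / R) (at_right 0) (at_left R)"
    using \<open>0 < R\<close> by real_asymp
  \<comment> \<open>Beyond R/2 one has d \<le> 1/2, as \<open>minor_arc_lower_bound\<close>
    requires, and t is positive, so the standard deviation is too.\<close>
  have ev: "eventually (\<lambda>t. t \<in> {R / 2<..<R}) (at_left R)"
    using \<open>0 < R\<close> by (intro eventually_at_leftI[of "R / 2"]) auto
  have in_range: "0 \<le> t" "t < R" "0 < 1 - t / R" "1 - t / R \<le> 1 / 2" "0 < ?\<sigma> t"
    if "t \<in> {R / 2<..<R}" for t
  proof -
    show t: "0 \<le> t" "t < R" and d: "0 < 1 - t / R" "1 - t / R \<le> 1 / 2"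
      using that \<open>0 < R\<close> by (auto simp: field_simps)
    have "0 < B * (1 - (1 - t / R)) / (1 - t / R)" using d that \<open>0 < B\<close> \<open>0 < R\<close> by simp
    then show "0 < ?\<sigma> t" using V_ge[OF t refl] by (simp add: sd[OF t])
  qed

  \<comment> \<open>The major arc\<close>
  have major: "norm (khinchin_char a t \<theta> * of_real (exp (\<theta>\<^sup>2 / 2)) - 1)
      \<le> exp (C3 / 6 * (1 - t / R) powr (3 * \<alpha> - lam - 4)) - 1"
    if t: "t \<in> {R / 2<..<R}" and \<theta>: "\<bar>\<theta>\<bar> \<le> h t * ?\<sigma> t" for t \<theta>
  proof -
    note r = in_range[OF t]
    define d \<phi> where "d = 1 - t / R" and "\<phi> = \<theta> / ?\<sigma> t"
    have \<phi>: "\<bar>\<phi>\<bar> \<le> d powr \<alpha>" using \<theta> r by (simp add: \<phi>_def h_def d_def field_simps)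
    \<comment> \<open>In terms of \<phi> the factor exp(\<theta>^2/2) cancels exactly the quadratic
      part of the exponent \<open>?T t \<phi>\<close>.\<close>
    have "\<theta> = \<phi> * ?\<sigma> t" using r by (simp add: \<phi>_def)
    then have "\<theta>\<^sup>2 / 2 = \<phi>\<^sup>2 / 2 * (?\<sigma> t)\<^sup>2" by (simp add: power_mult_distrib)
    also have "(?\<sigma> t)\<^sup>2 = ?V t"
      using sd[of t] r b by (simp add: suminf_nonneg sm1)
    finally have \<theta>2: "\<theta>\<^sup>2 / 2 = \<phi>\<^sup>2 / 2 * ?V t" .
    have "norm (?T t \<phi> + of_real (\<phi>\<^sup>2 / 2 * ?V t)) \<le> \<bar>\<phi>\<bar> ^ 3 / 6 * (\<Sum>n. real n ^ 3 * (b n * t ^ n))"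
      using r by (intro norm_compound_poisson_exponent_le w sm1) auto
    also have "\<dots> \<le> (d powr \<alpha>) ^ 3 / 6 * (C3 * d powr - (lam + 4))"
      using \<phi> C3(2)[of t] r w[of t]
      by (intro mult_mono divide_right_mono power_mono) (auto simp: d_def intro!: suminf_nonneg sm1)
    also have "\<dots> = C3 / 6 * d powr (3 * \<alpha> - lam - 4)"
    proof -
      have "(d powr \<alpha>) ^ 3 * d powr - (lam + 4) = d powr (3 * \<alpha> - lam - 4)"
        using r by (simp add: d_def powr_power flip: powr_add) (simp add: algebra_simps)
      then show ?thesis by simp
    qed
    finally have "norm (?T t \<phi> + of_real (\<theta>\<^sup>2 / 2)) \<le> C3 / 6 * d powr (3 * \<alpha> - lam - 4)"
      unfolding \<theta>2 .
    then have "exp (norm (?T t \<phi> + of_real (\<theta>\<^sup>2 / 2))) \<le> exp (C3 / 6 * d powr (3 * \<alpha> - lam - 4))"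
      by simp
    moreover have "khinchin_char a t \<theta> * of_real (exp (\<theta>\<^sup>2 / 2)) = exp (?T t \<phi> + of_real (\<theta>\<^sup>2 / 2))"
      using char[of t \<theta>] r unfolding \<phi>_def by (simp only: exp_add exp_of_real)
    ultimately show ?thesis
      using norm_exp_minus_one_le[of "?T t \<phi> + of_real (\<theta>\<^sup>2 / 2)"] by (simp only: d_def)
  qed

  \<comment> \<open>The minor arc\<close>
  have minor: "norm (khinchin_char a t \<theta>) \<le> exp (- (B * c * (1 - t / R) powr - \<epsilon>))"
    if t: "t \<in> {R / 2<..<R}" and \<theta>: "h t * ?\<sigma> t \<le> \<bar>\<theta>\<bar>" "\<bar>\<theta>\<bar> \<le> pi * ?\<sigma> t" for t \<theta>
  proof -
    note r = in_range[OF t]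
    define d \<phi> where "d = 1 - t / R" and "\<phi> = \<theta> / ?\<sigma> t"
    have d: "0 < d" "d \<le> 1 / 2" using r by (auto simp: d_def)
    have \<phi>: "d powr \<alpha> \<le> \<bar>\<phi>\<bar>" "\<bar>\<phi>\<bar> \<le> pi"
      using \<theta> r by (simp_all add: \<phi>_def h_def d_def field_simps)
    then have "\<phi> \<noteq> 0" using d powr_gt_zero[of d \<alpha>] by auto
    then obtain N where N: "1 \<le> N" "c * d powr - (\<beta> + 1) * min 1 ((\<phi> / d)\<^sup>2)
        \<le> (\<Sum>n\<in>{N..<3 * N}. real n powr \<beta> * (1 - d) ^ n * (1 - cos (real n * \<phi>)))"
      using c(2)[OF d _ \<phi>(2)] by blast
    have "d powr - \<epsilon> \<le> d powr - (\<beta> + 1) * min 1 ((\<phi> / d)\<^sup>2)"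
    proof -
      have "d powr (\<alpha> - 1) \<le> \<bar>\<phi>\<bar> / d"
        using \<phi> d by (simp add: powr_diff divide_right_mono)
      then have "(d powr (\<alpha> - 1))\<^sup>2 \<le> (\<bar>\<phi>\<bar> / d)\<^sup>2" by (intro power_mono) auto
      then have "d powr (2 * \<alpha> - 2) \<le> (\<phi> / d)\<^sup>2"
        using d by (simp add: powr_power power_divide algebra_simps)
      then have "d powr - (\<beta> + 1) * d powr (2 * \<alpha> - 2) \<le> d powr - (\<beta> + 1) * (\<phi> / d)\<^sup>2"
        by (intro mult_left_mono) auto
      moreover have "d powr - (\<beta> + 1) * d powr (2 * \<alpha> - 2) = d powr (2 * \<alpha> - \<beta> - 3)"
        using d by (simp flip: powr_add)
      moreover have "d powr - \<epsilon> \<le> d powr (2 * \<alpha> - \<beta> - 3)" "d powr - \<epsilon> \<le> d powr - (\<beta> + 1)"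
        using d by (auto intro!: powr_mono' simp: \<epsilon>_def)
      ultimately show ?thesis by (auto simp: min_def)
    qed
    then have "B * c * d powr - \<epsilon> \<le> B * (c * d powr - (\<beta> + 1) * min 1 ((\<phi> / d)\<^sup>2))"
      using \<open>0 < B\<close> c(1) by simp
    also have "\<dots> \<le> B * (\<Sum>n\<in>{N..<3 * N}. real n powr \<beta> * (1 - d) ^ n * (1 - cos (real n * \<phi>)))"
      using N(2) \<open>0 < B\<close> by (intro mult_left_mono) auto
    \<comment> \<open>Since (1 - d)^n = t^n / R^n, the lower bound on b_n can be inserted; N \<ge> 1
      keeps the window within its range.\<close>
    also have "\<dots> = (\<Sum>n\<in>{N..<3 * N}. B * (real n powr \<beta> / R ^ n) * t ^ n * (1 - cos (real n * \<phi>)))"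
      by (simp add: sum_distrib_left d_def power_divide mult.assoc)
    also have "\<dots> \<le> (\<Sum>n\<in>{N..<3 * N}. b n * t ^ n * (1 - cos (real n * \<phi>)))"
      using N(1) r by (intro sum_mono mult_right_mono lower) auto
    finally have "B * c * d powr - \<epsilon> \<le> \<dots>" .
    moreover have "Re (?T t \<phi>) \<le> - (\<Sum>n\<in>{N..<3 * N}. b n * t ^ n * (1 - cos (real n * \<phi>)))"
      using r by (intro Re_compound_poisson_exponent_le w sm1) auto
    ultimately have "Re (?T t \<phi>) \<le> - (B * c * d powr - \<epsilon>)" by linarith
    moreover have "norm (khinchin_char a t \<theta>) = exp (Re (?T t \<phi>))"
      using char[of t \<theta>] r unfolding \<phi>_def by (simp only: norm_exp_eq_Re)
    ultimately show ?thesis unfolding d_def by simp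
  qed

  have sd_le: "?\<sigma> t \<le> sqrt C2 * (1 - t / R) powr - ((lam + 3) / 2)" if t: "t \<in> {R / 2<..<R}" for t
  proof -
    note r = in_range[OF t]
    have "?\<sigma> t \<le> sqrt (C2 * (1 - t / R) powr - (lam + 3))"
      using C2(2)[of t] r by (simp add: sd)
    also have "\<dots> = sqrt C2 * (1 - t / R) powr - ((lam + 3) / 2)"
    proof -
      have "- (lam + 3) * (1 / 2) = - ((lam + 3) / 2)" by argo
      then show ?thesis
        by (simp only: real_sqrt_mult powr_half_sqrt[OF powr_ge_zero, symmetric] powr_powr)
    qed
    finally show ?thesis .
  qed

  \<comment> \<open>Verification of the three limits\<close>
  have "hayman_series a"
    unfolding hayman_series_def rad at_radius_def
  proof (intro conjI exI[of _ h] kh allI impI)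
    fix t :: real assume t: "0 \<le> t \<and> ereal t < ereal R"
    then have "0 < 1 - t / R" "1 - t / R \<le> 1" using \<open>0 < R\<close> by auto
    then have "0 < h t" "h t \<le> 1" using \<alpha> by (auto simp: h_def intro!: powr_le1)
    then show "0 < h t" "h t \<le> pi" using pi_gt3 by linarith+
  next
    have "((\<lambda>d. 1 * (exp (C3 / 6 * d powr (3 * \<alpha> - lam - 4)) - 1)) \<longlongrightarrow> 0) (at_right 0)"
      using \<alpha>(1) C3(1) by real_asymp
    from filterlim_compose[OF this filt]
    have "((\<lambda>t. 1 * (SUP \<theta> \<in> {\<theta>. \<bar>\<theta>\<bar> \<le> h t * ?\<sigma> t}.
          norm (khinchin_char a t \<theta> * of_real (exp (\<theta>\<^sup>2 / 2)) - 1))) \<longlongrightarrow> 0) (at_left R)"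
    proof (rule SUP_tendsto_zero[rotated])
      show "eventually (\<lambda>t. 0 \<le> (1::real) \<and> {\<theta>. \<bar>\<theta>\<bar> \<le> h t * ?\<sigma> t} \<noteq> {} \<and>
          (\<forall>\<theta>\<in>{\<theta>. \<bar>\<theta>\<bar> \<le> h t * ?\<sigma> t}.
            0 \<le> norm (khinchin_char a t \<theta> * of_real (exp (\<theta>\<^sup>2 / 2)) - 1) \<and>
            norm (khinchin_char a t \<theta> * of_real (exp (\<theta>\<^sup>2 / 2)) - 1)
              \<le> exp (C3 / 6 * (1 - t / R) powr (3 * \<alpha> - lam - 4)) - 1)) (at_left R)"
        using ev
      proof eventually_elim
        case (elim t)
        have "0 \<in> {\<theta>. \<bar>\<theta>\<bar> \<le> h t * ?\<sigma> t}"
          using in_range(5)[OF elim] by (simp add: h_def)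
        then show ?case using major[OF elim] by fastforce
      qed
    qed
    then show "((\<lambda>t. SUP \<theta> \<in> {\<theta>. \<bar>\<theta>\<bar> \<le> h t * ?\<sigma> t}.
          norm (khinchin_char a t \<theta> * of_real (exp (\<theta>\<^sup>2 / 2)) - 1)) \<longlongrightarrow> 0)
          (if ereal R = \<infinity> then at_top else at_left (real_of_ereal (ereal R)))"
      by simp
  next
    have lim: "((\<lambda>d. sqrt C2 * d powr - ((lam + 3) / 2) * exp (- (B * c * d powr - \<epsilon>))) \<longlongrightarrow> 0) (at_right 0)"
      using \<open>0 < B\<close> c(1) \<epsilon> by (intro powr_mult_exp_powr_tendsto_0) auto
    have "((\<lambda>t. ?\<sigma> t * exp (- (B * c * (1 - t / R) powr - \<epsilon>))) \<longlongrightarrow> 0) (at_left R)"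
    proof (rule tendsto_sandwich[OF _ _ tendsto_const filterlim_compose[OF lim filt]])
      show "eventually (\<lambda>t. 0 \<le> ?\<sigma> t * exp (- (B * c * (1 - t / R) powr - \<epsilon>))) (at_left R)"
        using ev by eventually_elim (use in_range(5) in \<open>auto intro: less_imp_le\<close>)
      show "eventually (\<lambda>t. ?\<sigma> t * exp (- (B * c * (1 - t / R) powr - \<epsilon>))
          \<le> sqrt C2 * (1 - t / R) powr - ((lam + 3) / 2) * exp (- (B * c * (1 - t / R) powr - \<epsilon>)))
          (at_left R)"
        using ev by eventually_elim (intro mult_right_mono sd_le; simp)
    qed
    then have "((\<lambda>t. ?\<sigma> t * (SUP \<theta> \<in> {\<theta>. h t * ?\<sigma> t \<le> \<bar>\<theta>\<bar> \<and> \<bar>\<theta>\<bar> \<le> pi * ?\<sigma> t}.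
          norm (khinchin_char a t \<theta>))) \<longlongrightarrow> 0) (at_left R)"
    proof (rule SUP_tendsto_zero[rotated])
      show "eventually (\<lambda>t. 0 \<le> ?\<sigma> t \<and>
          {\<theta>. h t * ?\<sigma> t \<le> \<bar>\<theta>\<bar> \<and> \<bar>\<theta>\<bar> \<le> pi * ?\<sigma> t} \<noteq> {} \<and>
          (\<forall>\<theta>\<in>{\<theta>. h t * ?\<sigma> t \<le> \<bar>\<theta>\<bar> \<and> \<bar>\<theta>\<bar> \<le> pi * ?\<sigma> t}. 0 \<le> norm (khinchin_char a t \<theta>) \<and>
            norm (khinchin_char a t \<theta>) \<le> exp (- (B * c * (1 - t / R) powr - \<epsilon>)))) (at_left R)"
        using ev
      proof eventually_elim
        case (elim t)
        note r = in_range[OF elim]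
        \<comment> \<open>This makes the minor arc nonempty: its endpoint pi \<sigma>(t) belongs to
          it.\<close>
        have "h t \<le> 1" using r \<alpha> by (auto simp: h_def intro!: powr_le1)
        then have "h t \<le> pi" using pi_gt3 by linarith
        then have "pi * ?\<sigma> t \<in> {\<theta>. h t * ?\<sigma> t \<le> \<bar>\<theta>\<bar> \<and> \<bar>\<theta>\<bar> \<le> pi * ?\<sigma> t}"
          using r(5) by (simp add: abs_mult)
        then show ?case using minor[OF elim] r(5) by fastforce
      qed
    qed
    then show "((\<lambda>t. ?\<sigma> t * (SUP \<theta> \<in> {\<theta>. h t * ?\<sigma> t \<le> \<bar>\<theta>\<bar> \<and> \<bar>\<theta>\<bar> \<le> pi * ?\<sigma> t}.
          norm (khinchin_char a t \<theta>))) \<longlongrightarrow> 0)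
          (if ereal R = \<infinity> then at_top else at_left (real_of_ereal (ereal R)))"
      by simp
  next
    have "filterlim (\<lambda>d. sqrt (B * (1 - d) / d)) at_top (at_right 0)"
      using \<open>0 < B\<close> by real_asymp
    from filterlim_compose[OF this filt]
    have "filterlim ?\<sigma> at_top (at_left R)"
    proof (rule filterlim_at_top_mono)
      show "eventually (\<lambda>t. sqrt (B * (1 - (1 - t / R)) / (1 - t / R)) \<le> ?\<sigma> t) (at_left R)"
        using ev
      proof eventually_elim
        case (elim t)
        note r = in_range[OF elim]
        show ?case using V_ge[OF r(1,2) refl] unfolding sd[OF r(1,2)] by (rule real_sqrt_le_mono)
      qed
    qed
    then show "filterlim ?\<sigma> at_top
        (if ereal R = \<infinity> then at_top else at_left (real_of_ereal (ereal R)))"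
      by simp
  qed
  then show ?thesis
    \<comment> \<open>Both radii equal R, so the expansion known on the disc of g holds on the whole
      disc of a.\<close>
    unfolding hayman_class_def using a(5) rad by (intro exI[of _ a]) simp
qed

end
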